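(* Consider the macro scheme (M) defined in the context. At time level $n$, suppose that $u^n_{i,j}\ge0$ and that $U^n_{i,j}:=[u^n_{i,j},\ \epsilon(\mathbf u^n_{i,j})^T]^T$ satisfies, for each mesh point $(x_i,y_j)$, the conditions (C1) $u^n_{i,j}\pm\epsilon\,a_x^T\mathbf u^n_{i,j}\ge0$; (C2) $u^n_{i,j}\pm\epsilon\,a_y^T\mathbf u^n_{i,j}\ge0$; (C3) $u^n_{i,j}\ge \hat a_{xx}^TU^n_{i,j}\ge0$; (C4) $u^n_{i,j}\ge \hat a_{yy}^TU^n_{i,j}\ge0$; (C5) $u^n_{i,j}\pm2\,\hat a_{xy}^TU^n_{i,j}\ge0$; (C6) $\left(\dfrac{\hat a_{xx}^T}{\Delta x^2}\pm2\dfrac{\hat a_{xy}^T}{\Delta x\Delta y}+\dfrac{\hat a_{yy}^T}{\Delta y^2}\right)U^n_{i,j}\ge0$ (each $\pm$ meaning both signs). Further, assume that $\Delta t$ satisfies (C7) $1-\gamma_{\max}\left(\dfrac{2\Theta\Delta t}{\epsilon\Delta x}+\dfrac{2\Theta\Delta t}{\epsilon\Delta y}+\dfrac{2\Delta t^2}{\epsilon^2\Delta x^2}+\dfrac{\Delta t^2}{2\epsilon^2\Delta x\Delta y}+\dfrac{2\Delta t^2}{\epsilon^2\Delta y^2}\right)\ge0$, where $\Theta=\frac1{2-\theta}$ and $\theta\in(1,2)$ is the minmod parameter. Then the macro scheme (M) guarantees that $u^{n+1}_{i,j}\ge0$ for each mesh point $(x_i,y_j)$.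
   Context: **Angular objects.** $\langle\cdot\rangle$ is integration over the unit sphere $\mathbb S^2\ni\Omega=(\Omega_x,\Omega_y,\Omega_z)$. Fix $N\ge1$. The real spherical harmonics of degree $\le N$, orthonormal for $\langle\cdot\rangle$, are collected in the vector $(m_0,\bar{\mathbf m}^T)^T$, where $m_0=(4\pi)^{-1/2}$ is the degree-0 harmonic and $\bar{\mathbf m}:\mathbb S^2\to\mathbb R^{\bar n}$ contains the harmonics $m_\ell^k$, $1\le\ell\le N$, $|k|\le\ell$ (the degree-1 ones being $\sqrt{3/4\pi}$ times $\Omega_y,\Omega_z,\Omega_x$). Set $a_x=\langle m_0\bar{\mathbf m}\Omega_x\rangle$, $a_y=\langle m_0\bar{\mathbf m}\Omega_y\rangle$, $a_{xx}=\langle m_0\bar{\mathbf m}\Omega_x^2\rangle$, $a_{yy}=\langle m_0\bar{\mathbf m}\Omega_y^2\rangle$, $a_{xy}=\langle m_0\bar{\mathbf m}\Omega_x\Omega_y\rangle$, all in $\mathbb R^{\bar n}$, and $\hat a_{xx}=[\tfrac13,a_{xx}^T]^T$, $\hat a_{yy}=[\tfrac13,a_{yy}^T]^T$, $\hat a_{xy}=[0,a_{xy}^T]^T$ in $\mathbb R^{\bar n+1}$. **Data.** $\epsilon>0$; $\sigma_s,\sigma_a:\mathbb R^2\to\mathbb R$ with $\sigma_s\ge\sigma_s^{\min}>0$, $\sigma_a\ge0$; $\sigma_F>0$ is a filter parameter; $\bar F\in\mathbb R^{\bar n\times\bar n}$ is diagonal with entries $\bar F_{(\ell,k),(\ell,k)}=-\ln\kappa(\ell/(N+1))$,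 where $\kappa:\mathbb R^+\to[0,1]$, $\kappa(0)=1$, is a filter function (nonzero at the points used). The mesh $(x_i,y_j)$, $i,j\in\mathbb Z$, on $\mathbb R^2$ is uniform with spacings $\Delta x,\Delta y>0$; the time step is $\Delta t>0$; $w_{i,j}$ denotes the value at $(x_i,y_j)$. The parameter $\theta\in(1,2)$ is fixed, and $\Theta=1/(2-\theta)$. The unknowns are $u^n_{i,j}\in\mathbb R$ (macro) and $\mathbf u^n_{i,j}\in\mathbb R^{\bar n}$ (micro). **Coefficients.** $\Gamma_{i,j}$ is the diagonal $\bar n\times\bar n$ matrix with entries $\epsilon^2\big(\epsilon^2(1+(\sigma_a)_{i,j}\Delta t+\sigma_F\Delta t\bar F_{(\ell,k),(\ell,k)})+(\sigma_s)_{i,j}\Delta t\big)^{-1}$; $\gamma_{i,j}$ is its diagonal entry for degree $\ell=1$; $\gamma_{\max}=\epsilon^2/(\epsilon^2+\sigma_s^{\min}\Delta t)$. Values of $\gamma$ at half-integer indices are harmonic averages of the adjacent mesh values: $\gamma_{i+\frac12,j}=2(\gamma_{i+1,j}^{-1}+\gamma_{i,j}^{-1})^{-1}$, $\gamma_{i,j+\frac12}=2(\gamma_{i,j+1}^{-1}+\gamma_{i,j}^{-1})^{-1}$, $\gamma_{i+\frac12,j+\frac12}=4\big(\sum_{k,\ell\in\{0,1\}}\gamma_{i+k,j+\ell}^{-1}\big)^{-1}$. **Difference operators.** $D^c_x\mathbf w_{i,j}=(\mathbf w_{i+1,j}-\mathbf w_{i-1,j})/(2\Delta x)$. The artificial dissipation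 operator is $$\delta_x w_{i,j}=\tfrac1{\Delta x^4}\Big[(w^+_{i+\frac12,j}-w^-_{i+\frac12,j})-(w^+_{i-\frac12,j}-w^-_{i-\frac12,j})\Big],$$ with $w^+_{i+\frac12,j}=w_{i+1,j}-\tfrac{\Delta x}2 s^x_{i+1,j}$, $w^-_{i+\frac12,j}=w_{i,j}+\tfrac{\Delta x}2 s^x_{i,j}$ and $s^x_{i,j}=\mathrm{minmod}\{\theta\frac{w_{i+1,j}-w_{i,j}}{\Delta x},\frac{w_{i+1,j}-w_{i-1,j}}{2\Delta x},\theta\frac{w_{i,j}-w_{i-1,j}}{\Delta x}\}$, where minmod returns the number of smallest absolute value in the convex hull of its arguments. $D^c_y,\delta_y$ are the analogues in $y$. With $c_0=\frac12$, $c_{\pm1}=\frac14$, $$\mathcal D_M(u_{i,j})=\tfrac{1}{3\Delta x^2}\sum_{\ell=0,\pm1}c_\ell\big(\gamma_{i+\frac12,j+\frac\ell2}(u_{i+1,j+\ell}-u_{i,j})-\gamma_{i-\frac12,j+\frac\ell2}(u_{i,j}-u_{i-1,j+\ell})\big)+\tfrac{1}{3\Delta y^2}\sum_{k=0,\pm1}c_k\big(\gamma_{i+\frac k2,j+\frac12}(u_{i+k,j+1}-u_{i,j})-\gamma_{i+\frac k2,j-\frac12}(u_{i,j}-u_{i+k,j-1})\big),$$ $$\begin{aligned}\mathcal D_m(\mathbf u_{i,j})=&\tfrac{a_{xx}^T}{\Delta x^2}\sum_{\ell=0,\pm1}c_\ell\big(\gamma_{i+\frac12,j+\frac\ell2}(\mathbf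 u_{i+1,j+\ell}-\mathbf u_{i,j})-\gamma_{i-\frac12,j+\frac\ell2}(\mathbf u_{i,j}-\mathbf u_{i-1,j+\ell})\big)\\&+\tfrac{a_{yy}^T}{\Delta y^2}\sum_{k=0,\pm1}c_k\big(\gamma_{i+\frac k2,j+\frac12}(\mathbf u_{i+k,j+1}-\mathbf u_{i,j})-\gamma_{i+\frac k2,j-\frac12}(\mathbf u_{i,j}-\mathbf u_{i+k,j-1})\big)\\&+\tfrac{a_{xy}^T}{2\Delta x\Delta y}\sum_{k=\pm1}\big(\gamma_{i+\frac k2,j+\frac k2}(\mathbf u_{i+k,j+k}-\mathbf u_{i,j})-\gamma_{i+\frac k2,j-\frac k2}(\mathbf u_{i+k,j-k}-\mathbf u_{i,j})\big).\end{aligned}$$ **Macro scheme (M).** For all $(i,j)$, $$(1+(\sigma_a)_{i,j}\Delta t)u^{n+1}_{i,j}=u^n_{i,j}+\tfrac{\Delta t^2}{\epsilon}\mathcal D_m(\mathbf u^n_{i,j})+\tfrac{\Delta t^2}{\epsilon^2}\mathcal D_M(u^n_{i,j})-\Delta t\Big((a_x^TD_x^c+a_y^TD_y^c)(\Gamma_{i,j}\mathbf u^n_{i,j})-\Theta\tfrac{\gamma_{\max}}{\epsilon}(\Delta x^3\delta_x+\Delta y^3\delta_y)u^n_{i,j}\Big),$$ where $D^c_x(\Gamma_{i,j}\mathbf u^n_{i,j})$ means $D^c_x$ applied to the mesh function $(i,j)\mapsto\Gamma_{i,j}\mathbf u^n_{i,j}$ (likewise for $y$). *)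

theory Defs
  imports "HOL-Analysis.Analysis" "HOL-Computational_Algebra.Polynomial"
begin

text \<open>Integration over the unit sphere with respect to surface measure, in polar coordinates
  (polar angle \<open>t\<close> measured from the third axis, azimuth \<open>p\<close>).\<close>

definition sphere_int :: "(real^3 \<Rightarrow> real) \<Rightarrow> real" where
  "sphere_int f =
     integral {0..pi} (\<lambda>t. integral {0..2*pi} (\<lambda>p.
       f (vector [sin t * cos p, sin t * sin p, cos t]) * sin t))"

text \<open>Legendre polynomials by Rodrigues' formula.\<close>

definition legendre :: "nat \<Rightarrow> real poly" where
  "legendre l = smult (1 / (2 ^ l * fact l)) ((pderiv ^^ l) ([:-1, 0, 1:] ^ l))"

text \<open>Real orthonormal spherical harmonics of degree \<open>l\<close> and order \<open>k\<close>, \<open>\<bar>k\<bar> \<le> l\<close>, without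
  the Condon--Shortley sign.  In polar coordinates, with \<open>m = \<bar>k\<bar>\<close>, the last two factors are
  the \<open>m\<close>-th derivative of the Legendre polynomial at \<open>cos t\<close>, and \<open>(sin t)\<^sup>m\<close> times \<open>cos (m p)\<close>
  (if \<open>k \<ge> 0\<close>) or \<open>sin (m p)\<close> (if \<open>k < 0\<close>): together, the associated Legendre function times
  the trigonometric factor.\<close>

definition sph_harm :: "nat \<Rightarrow> int \<Rightarrow> real^3 \<Rightarrow> real" where
  "sph_harm l k \<Omega> =
     (let m = nat \<bar>k\<bar>; z = Complex (\<Omega>$1) (\<Omega>$2) ^ m in
      (if k = 0 then 1 else sqrt 2)
      * sqrt ((2 * real l + 1) / (4 * pi) * fact (l - m) / fact (l + m))
      * poly ((pderiv ^^ m) (legendre l)) (\<Omega>$3)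
      * (if k \<ge> 0 then Re z else Im z))"

lemma sph_harm_degree_0: "sph_harm 0 0 \<Omega> = 1 / sqrt (4 * pi)"
  by (simp add: sph_harm_def legendre_def real_sqrt_divide)

lemma sph_harm_degree_1:
  "sph_harm 1 (-1) \<Omega> = sqrt (3 / (4 * pi)) * \<Omega>$2"
  "sph_harm 1 0 \<Omega> = sqrt (3 / (4 * pi)) * \<Omega>$3"
  "sph_harm 1 1 \<Omega> = sqrt (3 / (4 * pi)) * \<Omega>$1"
proof -
  have "(pderiv ^^ 1) ([:-1, 0, 1:] ^ 1 :: real poly) = [:0, 2:]"
    by (simp add: pderiv_pCons)
  then have leg: "legendre 1 = [:0, 1:]"
    by (simp add: legendre_def)
  have sq: "sqrt 2 * sqrt (3 / (4 * pi) / 2) = sqrt (3 / (4 * pi))"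
    by (simp add: real_sqrt_mult [symmetric])
  show "sph_harm 1 0 \<Omega> = sqrt (3 / (4 * pi)) * \<Omega>$3"
    using leg by (simp add: sph_harm_def)
  show "sph_harm 1 (-1) \<Omega> = sqrt (3 / (4 * pi)) * \<Omega>$2"
    using leg sq by (simp add: sph_harm_def pderiv_pCons)
  show "sph_harm 1 1 \<Omega> = sqrt (3 / (4 * pi)) * \<Omega>$1"
    using leg sq by (simp add: sph_harm_def pderiv_pCons)
qed

text \<open>Vectors are indexed by pairs \<open>(l, k)\<close> of degree and order: those in \<open>\<real>\<^sup>n\<close> (micro part,
  \<open>n\<close> the number of harmonics of degree \<open>1, \<dots>, N\<close>) by \<open>micro_index N\<close>, those in \<open>\<real>\<^sup>n\<^sup>+\<^sup>1\<close> by
  \<open>full_index N\<close>, where \<open>(0, 0)\<close> is the index of the macro component.  They are represented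
  by functions whose values outside the index set are never used.\<close>

type_synonym hvec = "nat \<times> int \<Rightarrow> real"

definition micro_index :: "nat \<Rightarrow> (nat \<times> int) set" where
  "micro_index N = {(l, k). 1 \<le> l \<and> l \<le> N \<and> \<bar>k\<bar> \<le> int l}"

definition full_index :: "nat \<Rightarrow> (nat \<times> int) set" where
  "full_index N = insert (0, 0) (micro_index N)"

definition dot_micro :: "nat \<Rightarrow> hvec \<Rightarrow> hvec \<Rightarrow> real" where
  "dot_micro N a b = (\<Sum>p\<in>micro_index N. a p * b p)"

definition dot_full :: "nat \<Rightarrow> hvec \<Rightarrow> hvec \<Rightarrow> real" where
  "dot_full N a b = (\<Sum>p\<in>full_index N. a p * b p)"

text \<open>\<open>augment c w\<close> is the vector \<open>[c, w\<^sup>T]\<^sup>T\<close>.\<close>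

definition augment :: "real \<Rightarrow> hvec \<Rightarrow> hvec" where
  "augment c w p = (if p = (0, 0) then c else w p)"

definition moment :: "(real^3 \<Rightarrow> real) \<Rightarrow> hvec" where
  "moment f p = sphere_int (\<lambda>\<Omega>. sph_harm 0 0 \<Omega> * sph_harm (fst p) (snd p) \<Omega> * f \<Omega>)"

definition a_x :: hvec where "a_x = moment (\<lambda>\<Omega>. \<Omega>$1)"
definition a_y :: hvec where "a_y = moment (\<lambda>\<Omega>. \<Omega>$2)"
definition a_xx :: hvec where "a_xx = moment (\<lambda>\<Omega>. (\<Omega>$1)\<^sup>2)"
definition a_yy :: hvec where "a_yy = moment (\<lambda>\<Omega>. (\<Omega>$2)\<^sup>2)"
definition a_xy :: hvec where "a_xy = moment (\<lambda>\<Omega>. \<Omega>$1 * \<Omega>$2)"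

definition ahat_xx :: hvec where "ahat_xx = augment (1/3) a_xx"
definition ahat_yy :: hvec where "ahat_yy = augment (1/3) a_yy"
definition ahat_xy :: hvec where "ahat_xy = augment 0 a_xy"

record scheme_data =
  max_deg :: nat                      \<comment> \<open>\<open>N\<close>\<close>
  eps :: real
  sig_s :: "real \<times> real \<Rightarrow> real"
  sig_a :: "real \<times> real \<Rightarrow> real"
  sig_s_min :: real
  sig_F :: real
  filt :: "real \<Rightarrow> real"              \<comment> \<open>filter function \<open>\<kappa>\<close>, relevant on \<open>[0, \<infinity>)\<close> only\<close>
  mesh_x :: "int \<Rightarrow> real"
  mesh_y :: "int \<Rightarrow> real"
  dx :: real
  dy :: real
  dt :: real
  theta :: real

definition Theta :: "scheme_data \<Rightarrow> real" where
  "Theta d = 1 / (2 - theta d)"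

definition sa_mesh :: "scheme_data \<Rightarrow> int \<Rightarrow> int \<Rightarrow> real" where
  "sa_mesh d i j = sig_a d (mesh_x d i, mesh_y d j)"

definition ss_mesh :: "scheme_data \<Rightarrow> int \<Rightarrow> int \<Rightarrow> real" where
  "ss_mesh d i j = sig_s d (mesh_x d i, mesh_y d j)"

text \<open>The diagonal matrices \<open>F\<close> and \<open>\<Gamma>\<^bsub>i,j\<^esub>\<close> are given by their diagonal entries.\<close>

definition Fbar :: "scheme_data \<Rightarrow> hvec" where
  "Fbar d p = - ln (filt d (real (fst p) / (real (max_deg d) + 1)))"

definition Gam :: "scheme_data \<Rightarrow> int \<Rightarrow> int \<Rightarrow> hvec" where
  "Gam d i j p =
     (eps d)\<^sup>2 / ((eps d)\<^sup>2 * (1 + sa_mesh d i j * dt d + sig_F d * dt d * Fbar d p)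
                 + ss_mesh d i j * dt d)"

text \<open>The entries of \<open>\<Gamma>\<^bsub>i,j\<^esub>\<close> do not depend on the order \<open>k\<close>, so \<open>(1, 0)\<close> represents degree 1.\<close>

definition gam :: "scheme_data \<Rightarrow> int \<Rightarrow> int \<Rightarrow> real" where
  "gam d i j = Gam d i j (1, 0)"

definition gam_max :: "scheme_data \<Rightarrow> real" where
  "gam_max d = (eps d)\<^sup>2 / ((eps d)\<^sup>2 + sig_s_min d * dt d)"

text \<open>Half-integer indices are doubled: \<open>gamh d p q\<close> is the value \<open>\<gamma>\<close> at \<open>(p/2, q/2)\<close>; thus
  \<open>gamh d (2*i+1) (2*j)\<close> is \<open>\<gamma>\<^bsub>i+1/2,j\<^esub>\<close>.\<close>

definition gamh :: "scheme_data \<Rightarrow> int \<Rightarrow> int \<Rightarrow> real" where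
  "gamh d p q =
     (let i = p div 2; j = q div 2 in
      if even p \<and> even q then gam d i j
      else if even q then 2 / (inverse (gam d (i+1) j) + inverse (gam d i j))
      else if even p then 2 / (inverse (gam d i (j+1)) + inverse (gam d i j))
      else 4 / (\<Sum>k\<in>{0,1}. \<Sum>l\<in>{0,1}. inverse (gam d (i+k) (j+l))))"

text \<open>The one-directional operators \<open>D\<^sup>c\<close> and \<open>\<delta>\<close> act on functions of a single mesh index, the
  other index being frozen; \<open>h\<close> is the spacing in the direction concerned.\<close>

definition Dc :: "real \<Rightarrow> (int \<Rightarrow> real) \<Rightarrow> int \<Rightarrow> real" where
  "Dc h w i = (w (i+1) - w (i-1)) / (2 * h)"

definition minmod :: "real \<Rightarrow> real \<Rightarrow> real \<Rightarrow> real" where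
  "minmod a b c = arg_min_on abs (convex hull {a, b, c})"

definition slope :: "real \<Rightarrow> real \<Rightarrow> (int \<Rightarrow> real) \<Rightarrow> int \<Rightarrow> real" where
  "slope th h w i =
     minmod (th * ((w (i+1) - w i) / h)) ((w (i+1) - w (i-1)) / (2 * h))
            (th * ((w i - w (i-1)) / h))"

text \<open>\<open>w_plus th h w i\<close> and \<open>w_minus th h w i\<close> are the reconstructed values at \<open>i + 1/2\<close>.\<close>

definition w_plus :: "real \<Rightarrow> real \<Rightarrow> (int \<Rightarrow> real) \<Rightarrow> int \<Rightarrow> real" where
  "w_plus th h w i = w (i+1) - h / 2 * slope th h w (i+1)"

definition w_minus :: "real \<Rightarrow> real \<Rightarrow> (int \<Rightarrow> real) \<Rightarrow> int \<Rightarrow> real" where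
  "w_minus th h w i = w i + h / 2 * slope th h w i"

definition dissip :: "real \<Rightarrow> real \<Rightarrow> (int \<Rightarrow> real) \<Rightarrow> int \<Rightarrow> real" where
  "dissip th h w i =
     1 / h ^ 4 * ((w_plus th h w i - w_minus th h w i)
                  - (w_plus th h w (i-1) - w_minus th h w (i-1)))"

definition cw :: "int \<Rightarrow> real" where
  "cw l = (if l = 0 then 1/2 else 1/4)"

text \<open>The three sums occurring in the diffusion operators, without their prefactors, for scalar
  mesh functions; on vector-valued mesh functions they act componentwise.\<close>

definition diff_xx :: "scheme_data \<Rightarrow> (int \<Rightarrow> int \<Rightarrow> real) \<Rightarrow> int \<Rightarrow> int \<Rightarrow> real" where
  "diff_xx d w i j =
     (\<Sum>l\<in>{-1, 0, 1}. cw l * (gamh d (2*i+1) (2*j+l) * (w (i+1) (j+l) - w i j)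
                            - gamh d (2*i-1) (2*j+l) * (w i j - w (i-1) (j+l))))"

definition diff_yy :: "scheme_data \<Rightarrow> (int \<Rightarrow> int \<Rightarrow> real) \<Rightarrow> int \<Rightarrow> int \<Rightarrow> real" where
  "diff_yy d w i j =
     (\<Sum>k\<in>{-1, 0, 1}. cw k * (gamh d (2*i+k) (2*j+1) * (w (i+k) (j+1) - w i j)
                            - gamh d (2*i+k) (2*j-1) * (w i j - w (i+k) (j-1))))"

definition diff_xy :: "scheme_data \<Rightarrow> (int \<Rightarrow> int \<Rightarrow> real) \<Rightarrow> int \<Rightarrow> int \<Rightarrow> real" where
  "diff_xy d w i j =
     (\<Sum>k\<in>{-1, 1}. gamh d (2*i+k) (2*j+k) * (w (i+k) (j+k) - w i j)
                  - gamh d (2*i+k) (2*j-k) * (w (i+k) (j-k) - w i j))"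

definition D_macro :: "scheme_data \<Rightarrow> (int \<Rightarrow> int \<Rightarrow> real) \<Rightarrow> int \<Rightarrow> int \<Rightarrow> real" where
  "D_macro d u i j =
     1 / (3 * (dx d)\<^sup>2) * diff_xx d u i j + 1 / (3 * (dy d)\<^sup>2) * diff_yy d u i j"

definition D_micro :: "scheme_data \<Rightarrow> (int \<Rightarrow> int \<Rightarrow> hvec) \<Rightarrow> int \<Rightarrow> int \<Rightarrow> real" where
  "D_micro d v i j =
     1 / (dx d)\<^sup>2 * dot_micro (max_deg d) a_xx (\<lambda>p. diff_xx d (\<lambda>i j. v i j p) i j)
   + 1 / (dy d)\<^sup>2 * dot_micro (max_deg d) a_yy (\<lambda>p. diff_yy d (\<lambda>i j. v i j p) i j)
   + 1 / (2 * dx d * dy d) * dot_micro (max_deg d) a_xy (\<lambda>p. diff_xy d (\<lambda>i j. v i j p) i j)"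

definition advection :: "scheme_data \<Rightarrow> (int \<Rightarrow> int \<Rightarrow> hvec) \<Rightarrow> int \<Rightarrow> int \<Rightarrow> real" where
  "advection d v i j =
     dot_micro (max_deg d) a_x (\<lambda>p. Dc (dx d) (\<lambda>i'. Gam d i' j p * v i' j p) i)
   + dot_micro (max_deg d) a_y (\<lambda>p. Dc (dy d) (\<lambda>j'. Gam d i j' p * v i j' p) j)"

text \<open>\<open>u\<close> and \<open>v\<close> are the macro and micro unknowns at the old time level, \<open>u'\<close> is the macro
  unknown at the new one.\<close>

definition macro_step ::
  "scheme_data \<Rightarrow> (int \<Rightarrow> int \<Rightarrow> real) \<Rightarrow> (int \<Rightarrow> int \<Rightarrow> hvec) \<Rightarrow> (int \<Rightarrow> int \<Rightarrow> real) \<Rightarrow> bool" where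
  "macro_step d u v u' \<longleftrightarrow>
     (\<forall>i j. (1 + sa_mesh d i j * dt d) * u' i j =
        u i j
        + (dt d)\<^sup>2 / eps d * D_micro d v i j
        + (dt d)\<^sup>2 / (eps d)\<^sup>2 * D_macro d u i j
        - dt d * (advection d v i j
                  - Theta d * (gam_max d / eps d)
                    * (dx d ^ 3 * dissip (theta d) (dx d) (\<lambda>i'. u i' j) i
                       + dy d ^ 3 * dissip (theta d) (dy d) (\<lambda>j'. u i j') j)))"

end

theory Submission
  imports Defs
begin

text \<open>With \<open>A\<close>, \<open>B\<close>, \<open>C\<close> the second moments of \<open>U\<close> against \<open>ahat_xx\<close>, \<open>ahat_yy\<close>, \<open>ahat_xy\<close>, the two
  diffusion operators merge into a single one acting on \<open>A\<close>, \<open>B\<close>, \<open>C\<close>, whose neighbour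
  contributions are nonnegative by (C3), (C4) and (C6).
  Since \<open>a_x\<close> and \<open>a_y\<close> vanish in degrees at least 2, only the degree 1 entry \<open>\<gamma>\<close> of \<open>\<Gamma>\<close> enters
  the advection, which by (C1) and (C2) is then bounded by \<open>\<gamma>\<^sub>m\<^sub>a\<^sub>x / \<epsilon>\<close> times half the sum of the
  neighbouring values of \<open>u\<close> over the mesh size.  Because the minmod slopes are one-sidedly bounded
  by \<open>\<theta>\<close> times a difference quotient, each neighbour keeps at least the weight \<open>1 - \<theta>/2\<close> in the
  dissipation, and the factor \<open>\<Theta> = 1/(2 - \<theta>)\<close> is exactly what makes this compensate the advection.
  What is left is a multiple of the central value of \<open>u\<close>, nonnegative by (C7).\<close>

section \<open>First moments of the spherical harmonics\<close>

lemma power_dvd_pderiv: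
  fixes p q :: "'a::idom poly"
  assumes "q ^ n dvd p"
  shows "q ^ (n - 1) dvd pderiv p"
proof (cases n)
  case (Suc k)
  from assms obtain r where "p = q ^ n * r" ..
  then have "pderiv p = q ^ k * (q * pderiv r + r * smult (of_nat (Suc k)) (pderiv q))"
    by (simp add: Suc pderiv_mult pderiv_power_Suc algebra_simps del: of_nat_Suc power_Suc)
       (simp add: algebra_simps)
  then show ?thesis
    using Suc by simp
qed simp

lemma power_dvd_pderiv_funpow:
  fixes q :: "'a::idom poly"
  shows "q ^ (n - j) dvd (pderiv ^^ j) (q ^ n)"
proof (induction j)
  case (Suc j)
  then show ?case
    using power_dvd_pderiv[OF Suc] by simp
qed simp

text \<open>Each derivative removes at most one factor x^2 - 1, so fewer than l of them leave one.
  This makes the boundary terms below vanish.\<close>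

lemma poly_rodrigues_eq_0:
  fixes x :: real
  assumes "j < l" "x\<^sup>2 = 1"
  shows "poly ((pderiv ^^ j) ([:-1, 0, 1:] ^ l)) x = 0"
proof -
  have "[:-1, 0, 1:] dvd ([:-1, 0, 1:] :: real poly) ^ (l - j)"
    using assms(1) by (intro dvd_power) simp
  also note power_dvd_pderiv_funpow
  finally obtain r where "(pderiv ^^ j) ([:-1, 0, 1:] ^ l) = [:-1, 0, 1:] * (r :: real poly)" ..
  then have "poly ((pderiv ^^ j) ([:-1, 0, 1:] ^ l)) x = poly [:-1, 0, 1:] x * poly r x"
    by (simp only: poly_mult)
  then show ?thesis
    using assms(2) by (simp add: power2_eq_square)
qed

text \<open>With x = cos t this is the integral of (1 - x^2) P_l' over [-1, 1], which integration by
  parts turns into a multiple of the integral of x P_l; that is zero for l >= 2 by orthogonality to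
  lower degrees.\<close>

lemma integral_legendre_deriv_sin_cubed:
  assumes "l \<ge> 2"
  shows "integral {0..pi} (\<lambda>t. poly (pderiv (legendre l)) (cos t) * sin t ^ 3) = 0"
proof -
  define q :: "real poly" where "q = [:-1, 0, 1:] ^ l"
  define S where "S = (pderiv ^^ (l - 1)) q"
  define T where "T = (pderiv ^^ (l - 2)) q"
  define c :: real where "c = 1 / (2 ^ l * fact l)"
  obtain k where l: "l = Suc (Suc k)"
    using assms by (metis add_2_eq_Suc le_Suc_ex)
  have dT: "pderiv T = S" and dS: "legendre l = smult c (pderiv S)"
    by (simp_all add: S_def T_def l legendre_def q_def c_def)
  define R where "R = pderiv S"
  \<comment> \<open>integrating \<open>(1 - x\<^sup>2) R'\<close> by parts twice\<close>
  define G where "G = [:1, 0, -1:] * R + [:0, 2:] * S - smult 2 T"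
  have dG: "pderiv G = [:1, 0, -1:] * pderiv R"
  proof (rule poly_eq_poly_eq_iff[THEN iffD1], rule ext)
    show "poly (pderiv G) x = poly ([:1, 0, -1:] * pderiv R) x" for x
      by (simp add: G_def pderiv_add pderiv_diff pderiv_minus pderiv_mult pderiv_smult pderiv_pCons dT
          R_def[symmetric] algebra_simps)
  qed
  \<comment> \<open>The first term vanishes through its factor 1 - x^2, \<open>S\<close> and
    \<open>T\<close> because they carry fewer than l derivatives.\<close>
  have G0: "poly G x = 0" if "x\<^sup>2 = 1" for x
    using that poly_rodrigues_eq_0[of "l - 1" l x] poly_rodrigues_eq_0[of "l - 2" l x] assms
    by (simp add: G_def S_def T_def q_def power2_eq_square)
  have "((\<lambda>t. poly (pderiv (legendre l)) (cos t) * sin t ^ 3) has_integral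
      (- c * poly G (cos pi)) - (- c * poly G (cos 0))) {0..pi}"
  proof (rule fundamental_theorem_of_calculus)
    fix t :: real
    have "((\<lambda>t. - c * poly G (cos t)) has_real_derivative
        - c * (poly (pderiv G) (cos t) * - sin t)) (at t within {0..pi})"
      by (auto intro!: derivative_eq_intros DERIV_chain2[OF poly_DERIV])
    moreover have "- c * (poly (pderiv G) (cos t) * - sin t)
        = poly (pderiv (legendre l)) (cos t) * sin t ^ 3"
    proof -
      \<comment> \<open>One sine is the differential of the substitution, the other two supply 1 -
        x^2.\<close>
      have "sin t ^ 3 = (1 - cos t * cos t) * sin t"
        using sin_squared_eq[of t] by (simp add: power3_eq_cube power2_eq_square)
      then show ?thesis
        by (simp only: dG dS pderiv_smult R_def[symmetric]) (simp add: algebra_simps)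
    qed
    ultimately show "((\<lambda>t. - c * poly G (cos t)) has_vector_derivative
        poly (pderiv (legendre l)) (cos t) * sin t ^ 3) (at t within {0..pi})"
      by (simp add: has_real_derivative_iff_has_vector_derivative)
  qed simp
  then show ?thesis
    using G0[of 1] G0[of "-1"] by (simp add: integral_unique)
qed

section \<open>Azimuthal integrals over a full period\<close>

lemma has_integral_cos_period:
  assumes "a \<in> \<int>" "a \<noteq> 0"
  shows "((\<lambda>p. cos (a * p)) has_integral 0) {0..2*pi}"
proof -
  have "((\<lambda>p. cos (a * p)) has_integral sin (a * (2*pi)) / a - sin (a * 0) / a) {0..2*pi}"
    using assms(2)
    by (intro fundamental_theorem_of_calculus)
       (auto intro!: derivative_eq_intros
         simp flip: has_real_derivative_iff_has_vector_derivative)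
  moreover have "sin (a * (2*pi)) = 0"
    using assms(1) sin_integer_2pi[of a] by (simp add: mult_ac)
  ultimately show ?thesis
    by simp
qed

lemma has_integral_sin_period:
  assumes "a \<in> \<int>"
  shows "((\<lambda>p. sin (a * p)) has_integral 0) {0..2*pi}"
proof (cases "a = 0")
  case False
  then have "((\<lambda>p. sin (a * p)) has_integral - cos (a * (2*pi)) / a - - cos (a * 0) / a) {0..2*pi}"
    by (intro fundamental_theorem_of_calculus)
       (auto intro!: derivative_eq_intros
         simp flip: has_real_derivative_iff_has_vector_derivative)
  moreover have "cos (a * (2*pi)) = 1"
    using assms cos_integer_2pi[of a] by (simp add: mult_ac)
  ultimately show ?thesis
    by simp
qed simp

text \<open>The product-to-sum formulas produce the frequencies m + 1 and m - 1; excluding m = 1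
  keeps both nonzero, as the cosine integrals require.\<close>

lemma integral_trig_products_period:
  assumes "m \<noteq> 1"
  shows "integral {0..2*pi} (\<lambda>p. cos (real m * p) * cos p) = 0" (is ?cc)
    and "integral {0..2*pi} (\<lambda>p. cos (real m * p) * sin p) = 0" (is ?cs)
    and "integral {0..2*pi} (\<lambda>p. sin (real m * p) * cos p) = 0" (is ?sc)
    and "integral {0..2*pi} (\<lambda>p. sin (real m * p) * sin p) = 0" (is ?ss)
proof -
  have Ints: "real m + 1 \<in> \<int>" "real m - 1 \<in> \<int>"
    by auto
  have nz: "real m + 1 \<noteq> 0" "real m - 1 \<noteq> 0"
    using assms by (auto simp: add_eq_0_iff)
  note c1 = has_integral_cos_period[OF Ints(1) nz(1)] and c2 = has_integral_cos_period[OF Ints(2) nz(2)]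
    and s1 = has_integral_sin_period[OF Ints(1)] and s2 = has_integral_sin_period[OF Ints(2)]
  note expand = cos_add cos_diff sin_add sin_diff algebra_simps
  have "((\<lambda>p. cos (real m * p) * cos p) has_integral (0 + 0) / 2) {0..2*pi}"
    by (rule has_integral_eq[OF _ has_integral_divide[OF has_integral_add[OF c1 c2]]])
       (simp add: expand)
  then show ?cc by (simp add: integral_unique)
  have "((\<lambda>p. cos (real m * p) * sin p) has_integral (0 - 0) / 2) {0..2*pi}"
    by (rule has_integral_eq[OF _ has_integral_divide[OF has_integral_diff[OF s1 s2]]])
       (simp add: expand)
  then show ?cs by (simp add: integral_unique)
  have "((\<lambda>p. sin (real m * p) * cos p) has_integral (0 + 0) / 2) {0..2*pi}"
    by (rule has_integral_eq[OF _ has_integral_divide[OF has_integral_add[OF s1 s2]]])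
       (simp add: expand)
  then show ?sc by (simp add: integral_unique)
  have "((\<lambda>p. sin (real m * p) * sin p) has_integral (0 - 0) / 2) {0..2*pi}"
    by (rule has_integral_eq[OF _ has_integral_divide[OF has_integral_diff[OF c2 c1]]])
       (simp add: expand)
  then show ?ss by (simp add: integral_unique)
qed

text \<open>The disjunction reflects the two ways in which a first moment vanishes: through the
  azimuth for orders other than 1 and -1, through the polar angle for these two.\<close>

lemma sphere_int_separated:
  assumes "\<And>t p. f (vector [sin t * cos p, sin t * sin p, cos t]) * sin t = c * (K t * g p)"
    and "integral {0..2*pi} g = 0 \<or> integral {0..pi} K = 0"
  shows "sphere_int f = 0"
proof -
  have "sphere_int f = c * (integral {0..pi} K * integral {0..2*pi} g)"
    by (simp add: sphere_int_def assms(1))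
  then show ?thesis
    using assms(2) by auto
qed

lemma Complex_polar_power:
  "Complex (s * cos p) (s * sin p) ^ m
    = Complex (s ^ m * cos (real m * p)) (s ^ m * sin (real m * p))"
proof -
  have "Complex (s * cos p) (s * sin p) = of_real s * cis p"
    by (simp add: complex_eq_iff)
  then have "Complex (s * cos p) (s * sin p) ^ m = of_real (s ^ m) * cis (real m * p)"
    by (simp only: power_mult_distrib Complex.DeMoivre of_real_power)
  then show ?thesis
    by (simp add: complex_eq_iff)
qed

text \<open>The components of \<Omega> are harmonics of degree 1 up to a constant, so this is
  orthogonality between different degrees, obtained here by separating the angles.\<close>

lemma a_x_a_y_eq_0:
  assumes "l \<ge> 2"
  shows "a_x (l, k) = 0" "a_y (l, k) = 0"
proof -
  define m where "m = nat \<bar>k\<bar>"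
  \<comment> \<open>The degree 0 harmonic is constant, so its value at the origin stands for all its
    values.\<close>
  define c where "c = sph_harm 0 0 0 * ((if k = 0 then 1 else sqrt 2)
      * sqrt ((2 * real l + 1) / (4 * pi) * fact (l - m) / fact (l + m)))"
  \<comment> \<open>Of the sines, \<open>m\<close> come from the harmonic, one from the component of
    \<Omega> and one from the surface element.\<close>
  define K where "K = (\<lambda>t. poly ((pderiv ^^ m) (legendre l)) (cos t) * sin t ^ (m + 2))"
  define g where "g = (\<lambda>p. if k \<ge> 0 then cos (real m * p) else sin (real m * p))"
  have h: "sph_harm 0 0 \<Omega> * sph_harm l k \<Omega> * f = c * (poly ((pderiv ^^ m) (legendre l)) (cos t)
      * sin t ^ m * g p * f)" if "\<Omega> = vector [sin t * cos p, sin t * sin p, cos t]" for \<Omega> t p f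
    by (simp add: that sph_harm_degree_0 c_def sph_harm_def[of l] Let_def m_def[symmetric] g_def
        Complex_polar_power vector_3)
  have K: "integral {0..pi} K = 0" if "m = 1"
    using integral_legendre_deriv_sin_cubed[OF assms] by (simp add: K_def that numeral_3_eq_3)
  have gx: "integral {0..2*pi} (\<lambda>p. g p * cos p) = 0"
    and gy: "integral {0..2*pi} (\<lambda>p. g p * sin p) = 0" if "m \<noteq> 1"
    using integral_trig_products_period[OF that] by (cases "k \<ge> 0"; simp add: g_def)+
  show "a_x (l, k) = 0"
    unfolding a_x_def moment_def
    by (rule sphere_int_separated[where c = c and K = K and g = "\<lambda>p. g p * cos p"])
       (simp add: h[OF refl] K_def vector_3, use K gx in blast)
  show "a_y (l, k) = 0"
    unfolding a_y_def moment_def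
    by (rule sphere_int_separated[where c = c and K = K and g = "\<lambda>p. g p * sin p"])
       (simp add: h[OF refl] K_def vector_3, use K gy in blast)
qed

section \<open>The minmod dissipation\<close>

text \<open>\<open>arg_min_on\<close> is a choice that means something only if a minimizer exists;
  compactness of the hull provides one.\<close>

lemma minmod_bounds:
  fixes a b c :: real
  shows "minmod a b c \<in> convex hull {a, b, c}"
    and "x \<in> convex hull {a, b, c} \<Longrightarrow> \<bar>minmod a b c\<bar> \<le> \<bar>x\<bar>"
proof -
  let ?H = "convex hull {a, b, c}"
  have "compact ?H"
    by (intro finite_imp_compact_convex_hull) simp
  moreover have "?H \<noteq> {}" by simp
  moreover have "continuous_on ?H (abs :: real \<Rightarrow> real)"
    by (intro continuous_intros)
  ultimately obtain s where "s \<in> ?H" "\<forall>y\<in>?H. \<bar>s\<bar> \<le> \<bar>y\<bar>"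
    using continuous_attains_inf by blast
  then have "is_arg_min abs (\<lambda>x. x \<in> ?H) s"
    by (auto simp: is_arg_min_linorder)
  then have "is_arg_min abs (\<lambda>x. x \<in> ?H) (minmod a b c)"
    unfolding minmod_def arg_min_on_def arg_min_def by (rule someI)
  then show "minmod a b c \<in> ?H" "x \<in> ?H \<Longrightarrow> \<bar>minmod a b c\<bar> \<le> \<bar>x\<bar>"
    by (auto simp: is_arg_min_linorder)
qed

text \<open>If the minmod value and \<open>x\<close> had opposite signs, the segment joining them
  inside the hull would contain 0, and minimality would force the value to be 0. With equal signs,
  minimality alone suffices.\<close>

lemma minmod_between_0:
  assumes "x \<in> {a, b, c}"
  shows "min 0 x \<le> minmod a b c" "minmod a b c \<le> max 0 x"
proof -
  let ?H = "convex hull {a, b, c}" and ?s = "minmod a b c"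
  have x: "x \<in> ?H"
    using assms hull_subset[of "{a, b, c}" convex] by blast
  have seg: "closed_segment ?s x \<subseteq> ?H"
    by (intro closed_segment_subset minmod_bounds x convex_convex_hull)
  have le: "\<bar>?s\<bar> \<le> \<bar>x\<bar>"
    by (rule minmod_bounds(2)[OF x])
  have zero: "?s = 0" if "0 \<in> closed_segment ?s x"
    using minmod_bounds(2)[of 0 a b c] seg that by auto
  show "min 0 x \<le> ?s" "?s \<le> max 0 x"
    using le zero by (auto simp: closed_segment_eq_real_ivl min_def max_def abs_if split: if_splits)
qed

text \<open>The slope at \<open>i\<close> occurs in both brackets and cancels, so only the slopes at
  the two neighbours have to be estimated.\<close>

lemma dissip_ge:
  assumes h: "h > 0" and th: "th \<ge> 0" and w: "\<And>i. w i \<ge> 0"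
  shows "h ^ 3 * dissip th h w i \<ge> ((1 - th / 2) * (w (i+1) + w (i-1)) - 2 * w i) / h"
proof -
  have up: "h * slope th h w (i+1) \<le> th * w (i+1)"
  proof -
    \<comment> \<open>Of the three quotients at i + 1, the one reaching back to \<open>i\<close> is
      chosen: dropping \<open>w i\<close>, which is nonnegative, leaves a bound by the neighbour
      alone. At i - 1 the forward quotient plays this part.\<close>
    have "slope th h w (i+1) \<le> max 0 (th * ((w (i+1) - w i) / h))"
      unfolding slope_def by (rule minmod_between_0) simp
    also have "\<dots> \<le> th * w (i+1) / h"
      using h th w[of i] w[of "i+1"] by (auto simp: divide_right_mono mult_left_mono)
    finally show ?thesis
      using h by (simp add: field_simps)
  qed
  have lo: "h * slope th h w (i-1) \<ge> - (th * w (i-1))"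
  proof -
    have "- (th * w (i-1) / h) \<le> min 0 (th * ((w i - w (i-1)) / h))"
      using h th w[of i] w[of "i-1"] by (auto simp: divide_simps algebra_simps)
    also have "\<dots> \<le> slope th h w (i-1)"
      unfolding slope_def by (rule minmod_between_0) simp
    finally show ?thesis
      using h by (simp add: field_simps)
  qed
  have "h ^ 3 * dissip th h w i = (w (i+1) + w (i-1) - 2 * w i
      - h * slope th h w (i+1) / 2 + h * slope th h w (i-1) / 2) / h"
    using h by (simp add: dissip_def w_plus_def w_minus_def field_simps eval_nat_numeral)
  also have "\<dots> \<ge> ((1 - th / 2) * (w (i+1) + w (i-1)) - 2 * w i) / h"
    using up lo h by (intro divide_right_mono) (auto simp: algebra_simps)
  finally show ?thesis .
qed

section \<open>The discrete operators\<close>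

lemma finite_micro_index: "finite (micro_index N)"
proof (rule finite_subset)
  show "micro_index N \<subseteq> {..N} \<times> {- int N..int N}"
    by (auto simp: micro_index_def)
qed simp

lemma dot_full_augment:
  "dot_full N a (augment c w) = a (0, 0) * c + dot_micro N a w"
proof -
  have 0: "(0, 0) \<notin> micro_index N"
    by (simp add: micro_index_def)
  then have "(\<Sum>p\<in>micro_index N. a p * augment c w p) = (\<Sum>p\<in>micro_index N. a p * w p)"
    by (intro sum.cong) (auto simp: augment_def)
  then show ?thesis
    using 0 finite_micro_index by (simp add: dot_full_def dot_micro_def full_index_def augment_def)
qed

lemma dot_micro_augment: "dot_micro N (augment c a) w = dot_micro N a w"
  unfolding dot_micro_def by (intro sum.cong) (auto simp: micro_index_def augment_def)

lemma dot_micro_scale: "dot_micro N a (\<lambda>p. c * w p) = c * dot_micro N a w"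
  by (simp add: dot_micro_def sum_distrib_left mult_ac)

lemma dot_micro_add: "dot_micro N a (\<lambda>p. w p + z p) = dot_micro N a w + dot_micro N a z"
  by (simp add: dot_micro_def sum.distrib ring_distribs)

lemma dot_micro_diff: "dot_micro N a (\<lambda>p. w p - z p) = dot_micro N a w - dot_micro N a z"
  by (simp add: dot_micro_def sum_subtractf ring_distribs)

section \<open>The merged diffusion operator\<close>

lemma dot_micro_diff_xx:
  "dot_micro N a (\<lambda>p. diff_xx d (\<lambda>i j. v i j p) i j) = diff_xx d (\<lambda>i j. dot_micro N a (v i j)) i j"
  by (simp add: diff_xx_def dot_micro_add dot_micro_diff dot_micro_scale)

lemma dot_micro_diff_yy:
  "dot_micro N a (\<lambda>p. diff_yy d (\<lambda>i j. v i j p) i j) = diff_yy d (\<lambda>i j. dot_micro N a (v i j)) i j"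
  by (simp add: diff_yy_def dot_micro_add dot_micro_diff dot_micro_scale)

lemma dot_micro_diff_xy:
  "dot_micro N a (\<lambda>p. diff_xy d (\<lambda>i j. v i j p) i j) = diff_xy d (\<lambda>i j. dot_micro N a (v i j)) i j"
  by (simp add: diff_xy_def dot_micro_add dot_micro_diff dot_micro_scale)

text \<open>The macro entries 1/3, 1/3 and 0 of the augmented moment vectors account for
  \<open>D_macro\<close>, which has no mixed term; the \<epsilon> in the micro part of U evens out
  the two prefactors.\<close>

lemma diffusion_eq:
  assumes "eps d \<noteq> 0"
  shows "(dt d)\<^sup>2 / eps d * D_micro d v i j + (dt d)\<^sup>2 / (eps d)\<^sup>2 * D_macro d u i j
    = (dt d)\<^sup>2 / (eps d)\<^sup>2 *
      (diff_xx d (\<lambda>i j. u i j / 3 + eps d * dot_micro (max_deg d) a_xx (v i j)) i j / (dx d)\<^sup>2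
       + diff_yy d (\<lambda>i j. u i j / 3 + eps d * dot_micro (max_deg d) a_yy (v i j)) i j / (dy d)\<^sup>2
       + diff_xy d (\<lambda>i j. eps d * dot_micro (max_deg d) a_xy (v i j)) i j / (2 * dx d * dy d))"
proof -
  let ?N = "max_deg d"
  have xx: "diff_xx d (\<lambda>i j. u i j / 3 + eps d * f i j) i j = diff_xx d u i j / 3 + eps d * diff_xx d f i j"
    for f
    by (simp add: diff_xx_def algebra_simps add_divide_distrib diff_divide_distrib)
  have yy: "diff_yy d (\<lambda>i j. u i j / 3 + eps d * f i j) i j = diff_yy d u i j / 3 + eps d * diff_yy d f i j"
    for f
    by (simp add: diff_yy_def algebra_simps add_divide_distrib diff_divide_distrib)
  have xy: "diff_xy d (\<lambda>i j. eps d * f i j) i j = eps d * diff_xy d f i j" for f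
    by (simp add: diff_xy_def algebra_simps)
  have e: "(dt d)\<^sup>2 / eps d = (dt d)\<^sup>2 / (eps d)\<^sup>2 * eps d"
    using assms by (simp add: power2_eq_square)
  show ?thesis
    unfolding D_micro_def D_macro_def dot_micro_diff_xx dot_micro_diff_yy dot_micro_diff_xy xx yy xy e
    by (simp add: algebra_simps add_divide_distrib)
qed

text \<open>In the nine-point stencil the edge neighbours enter through \<open>A\<close> or \<open>B\<close> alone and the corner
  neighbours exactly through the combinations in the last two hypotheses.  All eight contributions
  are therefore nonnegative, and only the central value has to be bounded.\<close>

lemma diffusion_ge:
  assumes h: "dx d > 0" "dy d > 0"
    and g0: "\<And>p q. gamh d p q \<ge> 0" and gM: "\<And>p q. gamh d p q \<le> M"
    and A: "\<And>i j. 0 \<le> A i j" "A i j \<le> u" and B: "\<And>i j. 0 \<le> B i j" "B i j \<le> u"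
    and C: "2 * \<bar>C i j\<bar> \<le> u"
    and pos: "\<And>i j. 0 \<le> A i j / (dx d)\<^sup>2 + 2 * C i j / (dx d * dy d) + B i j / (dy d)\<^sup>2"
    and neg: "\<And>i j. 0 \<le> A i j / (dx d)\<^sup>2 - 2 * C i j / (dx d * dy d) + B i j / (dy d)\<^sup>2"
  shows "diff_xx d A i j / (dx d)\<^sup>2 + diff_yy d B i j / (dy d)\<^sup>2 + diff_xy d C i j / (2 * dx d * dy d)
    \<ge> - (M * u * (2 / (dx d)\<^sup>2 + 1 / (2 * dx d * dy d) + 2 / (dy d)\<^sup>2))"
proof -
  define X where "X = 1 / (dx d)\<^sup>2"
  define Y where "Y = 1 / (dy d)\<^sup>2"
  define Z where "Z = 1 / (dx d * dy d)"
  have XYZ: "X \<ge> 0" "Y \<ge> 0" "Z \<ge> 0"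
    using h by (simp_all add: X_def Y_def Z_def)
  define P where "P i j = A i j * X + 2 * C i j * Z + B i j * Y" for i j
  define Q where "Q i j = A i j * X - 2 * C i j * Z + B i j * Y" for i j
  have PQ: "P i j \<ge> 0" "Q i j \<ge> 0" for i j
    using pos[of i j] neg[of i j] by (simp_all add: P_def Q_def X_def Y_def Z_def)
  define E W N S NE NW SE SW where
    "E = gamh d (2*i+1) (2*j)" and "W = gamh d (2*i-1) (2*j)"
    and "N = gamh d (2*i) (2*j+1)" and "S = gamh d (2*i) (2*j-1)"
    and "NE = gamh d (2*i+1) (2*j+1)" and "NW = gamh d (2*i-1) (2*j+1)"
    and "SE = gamh d (2*i+1) (2*j-1)" and "SW = gamh d (2*i-1) (2*j-1)"
  note gdefs = E_def W_def N_def S_def NE_def NW_def SE_def SW_def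
  have g_ge: "E \<ge> 0" "W \<ge> 0" "N \<ge> 0" "S \<ge> 0" "NE \<ge> 0" "NW \<ge> 0" "SE \<ge> 0" "SW \<ge> 0"
    unfolding gdefs by (rule g0)+
  have g_le: "E \<le> M" "W \<le> M" "N \<le> M" "S \<le> M" "NE \<le> M" "NW \<le> M" "SE \<le> M" "SW \<le> M"
    unfolding gdefs by (rule gM)+
  define cA where "cA = (E + W) / 2 + (NE + NW + SE + SW) / 4"
  define cB where "cB = (N + S) / 2 + (NE + NW + SE + SW) / 4"
  define cC where "cC = NE + SW - NW - SE"
  \<comment> \<open>A corner has weight 1/4 in each of the \<open>xx\<close> and \<open>yy\<close>
    sums and 1/2 in the mixed term, hence a quarter of \<open>P\<close> or \<open>Q\<close>.\<close>
  have stencil: "diff_xx d A i j * X + diff_yy d B i j * Y + diff_xy d C i j * Z / 2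
    = (E * A (i+1) j + W * A (i-1) j) * X / 2 + (N * B i (j+1) + S * B i (j-1)) * Y / 2
      + (NE * P (i+1) (j+1) + SW * P (i-1) (j-1) + NW * Q (i-1) (j+1) + SE * Q (i+1) (j-1)) / 4
      - (cA * A i j * X + cB * B i j * Y + cC * C i j * Z / 2)"
    by (simp add: diff_xx_def diff_yy_def diff_xy_def cw_def gdefs P_def Q_def cA_def cB_def cC_def
        field_simps)
  \<comment> \<open>Two halves and four quarters of values at most \<open>M\<close> add up to at
    most 2 \<open>M\<close>.\<close>
  have "0 \<le> cA" "cA \<le> 2 * M" "0 \<le> cB" "cB \<le> 2 * M"
    using g_ge g_le by (simp_all add: cA_def cB_def field_simps)
  then have "cA * A i j \<le> (2 * M) * u" "cB * B i j \<le> (2 * M) * u"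
    using A(1)[of i j] A(2) B(1)[of i j] B(2) by (auto intro!: mult_mono)
  then have "cA * A i j * X \<le> 2 * M * u * X" "cB * B i j * Y \<le> 2 * M * u * Y"
    using XYZ by (auto intro: mult_right_mono)
  moreover have "cC * C i j * Z / 2 \<le> M * u * Z / 2"
  proof -
    \<comment> \<open>Two of the four values in [0, M] enter with each sign, so at most two of them
      accumulate.\<close>
    have "\<bar>cC\<bar> \<le> 2 * M"
      using g_ge g_le by (simp add: cC_def)
    then have "\<bar>cC\<bar> * \<bar>C i j\<bar> \<le> (2 * M) * (u / 2)"
      using C by (intro mult_mono) auto
    then have "cC * C i j \<le> M * u"
      using abs_ge_self[of "cC * C i j"] by (simp add: abs_mult)
    then show ?thesis
      using XYZ by (simp add: mult_right_mono)
  qed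
  moreover have "0 \<le> (E * A (i+1) j + W * A (i-1) j) * X / 2 + (N * B i (j+1) + S * B i (j-1)) * Y / 2
      + (NE * P (i+1) (j+1) + SW * P (i-1) (j-1) + NW * Q (i-1) (j+1) + SE * Q (i+1) (j-1)) / 4"
    using g_ge XYZ A B PQ by simp
  ultimately have "diff_xx d A i j * X + diff_yy d B i j * Y + diff_xy d C i j * Z / 2
      \<ge> - (2 * M * u * X + 2 * M * u * Y + M * u * Z / 2)"
    unfolding stencil by linarith
  then show ?thesis
    by (simp add: X_def Y_def Z_def algebra_simps)
qed

section \<open>Advection against dissipation\<close>

lemma dot_micro_Dc:
  assumes deg1: "\<And>p. p \<in> micro_index N \<Longrightarrow> fst p \<noteq> 1 \<Longrightarrow> a p = 0"
    and G: "\<And>i p. fst p = 1 \<Longrightarrow> G i p = g i"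
  shows "dot_micro N a (\<lambda>p. Dc h (\<lambda>i. G i p * v i p) i) = Dc h (\<lambda>i. g i * dot_micro N a (v i)) i"
proof -
  have "a p * Dc h (\<lambda>i. G i p * v i p) i = Dc h (\<lambda>i. g i * (a p * v i p)) i"
    if "p \<in> micro_index N" for p
    \<comment> \<open>Outside degree 1 both sides carry the factor \<open>a p\<close> = 0, so
      \<open>G\<close> has to agree with \<open>g\<close> only in degree 1.\<close>
    using deg1[OF that] G[of p] by (cases "fst p = 1") (simp_all add: Dc_def algebra_simps)
  then have "dot_micro N a (\<lambda>p. Dc h (\<lambda>i. G i p * v i p) i)
      = (\<Sum>p\<in>micro_index N. Dc h (\<lambda>i. g i * (a p * v i p)) i)"
    unfolding dot_micro_def by (intro sum.cong) auto
  also have "\<dots> = Dc h (\<lambda>i. g i * dot_micro N a (v i)) i"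
    by (simp add: Dc_def dot_micro_def sum_subtractf sum_distrib_left flip: sum_divide_distrib)
  finally show ?thesis .
qed

lemma advection_eq:
  "advection d v i j =
     Dc (dx d) (\<lambda>i'. gam d i' j * dot_micro (max_deg d) a_x (v i' j)) i
   + Dc (dy d) (\<lambda>j'. gam d i j' * dot_micro (max_deg d) a_y (v i j')) j"
proof -
  have "a_x p = 0" "a_y p = 0" if "p \<in> micro_index N" "fst p \<noteq> 1" for p N
    using that a_x_a_y_eq_0[of "fst p" "snd p"] by (auto simp: micro_index_def)
  moreover have "Gam d i j p = gam d i j" if "fst p = 1" for i j p
    using that by (simp add: gam_def Gam_def Fbar_def)
  ultimately show ?thesis
    unfolding advection_def by (simp add: dot_micro_Dc)
qed

lemma advection_dissip_ge:
  assumes h: "h > 0" and e: "e > 0" and th: "0 \<le> th" "th < 2"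
    and w: "\<And>i. w i \<ge> 0"
    and g: "\<And>i. 0 \<le> g i" "\<And>i. g i \<le> M"
    and f: "\<And>i. e * \<bar>f i\<bar> \<le> w i"
  shows "1 / (2 - th) * (M / e) * (h ^ 3 * dissip th h w i) - Dc h (\<lambda>i. g i * f i) i
    \<ge> - (2 * (1 / (2 - th)) * M * w i / (e * h))"
proof -
  have M: "M \<ge> 0"
    using g[of 0] by linarith
  have gf: "\<bar>g i * f i\<bar> \<le> M * w i / e" for i
  proof -
    have "\<bar>g i\<bar> * \<bar>f i\<bar> \<le> M * (w i / e)"
      using g[of i] f[of i] M e by (intro mult_mono) (auto simp: field_simps)
    then show ?thesis
      by (simp add: abs_mult)
  qed
  have "1 / (2 - th) * (M / e) * (((1 - th / 2) * (w (i+1) + w (i-1)) - 2 * w i) / h)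
      \<le> 1 / (2 - th) * (M / e) * (h ^ 3 * dissip th h w i)"
    using dissip_ge[OF h th(1) w] M e th(2) by (intro mult_left_mono) auto
  \<comment> \<open>Since (1 - th/2) / (2 - th) = 1/2, the neighbours get exactly the weight they
    have in the centred difference.\<close>
  moreover have "1 / (2 - th) * (M / e) * (((1 - th / 2) * (w (i+1) + w (i-1)) - 2 * w i) / h)
      = (M * w (i+1) / e + M * w (i-1) / e) / (2 * h) - 2 * (1 / (2 - th)) * M * w i / (e * h)"
    using h e th(2) by (simp add: divide_simps) (simp add: algebra_simps)
  moreover have "Dc h (\<lambda>i. g i * f i) i \<le> (M * w (i+1) / e + M * w (i-1) / e) / (2 * h)"
    unfolding Dc_def using gf[of "i+1"] gf[of "i-1"] h by (intro divide_right_mono) auto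
  ultimately show ?thesis
    by linarith
qed

section \<open>Bounds for the coefficients\<close>

text \<open>For filter values in (0, 1] the entry -ln \<kappa> is nonnegative, so absorption and
  filter only enlarge the denominator; replacing the scattering by its minimum leaves that of
  \<open>gam_max\<close>.\<close>

lemma gam_bounds:
  assumes "max_deg d \<ge> 1" "eps d > 0" "sig_s_min d > 0" "\<forall>p. sig_s d p \<ge> sig_s_min d"
    and "\<forall>p. sig_a d p \<ge> 0" "sig_F d > 0"
    and "\<forall>r\<ge>0. 0 \<le> filt d r \<and> filt d r \<le> 1"
    and "\<forall>l\<in>{1..max_deg d}. filt d (real l / (real (max_deg d) + 1)) \<noteq> 0"
    and "dt d > 0"
  shows "0 < gam d i j" "gam d i j \<le> gam_max d"
proof -
  let ?r = "real 1 / (real (max_deg d) + 1)"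
  have "filt d ?r \<noteq> 0"
    using assms(1,8) by (metis atLeastAtMost_iff order_refl)
  moreover have "0 \<le> filt d ?r" "filt d ?r \<le> 1"
    using assms(7) by auto
  ultimately have "ln (filt d ?r) \<le> 0"
    by simp
  then have F: "Fbar d (1, 0) \<ge> 0"
    by (simp add: Fbar_def)
  let ?b = "(eps d)\<^sup>2 * (1 + sa_mesh d i j * dt d + sig_F d * dt d * Fbar d (1, 0)) + ss_mesh d i j * dt d"
  have "(eps d)\<^sup>2 * 1 \<le> (eps d)\<^sup>2 * (1 + sa_mesh d i j * dt d + sig_F d * dt d * Fbar d (1, 0))"
    using F assms by (intro mult_left_mono) (auto simp: sa_mesh_def)
  moreover have "sig_s_min d * dt d \<le> ss_mesh d i j * dt d"
    using assms by (intro mult_right_mono) (auto simp: ss_mesh_def)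
  ultimately have le: "(eps d)\<^sup>2 + sig_s_min d * dt d \<le> ?b"
    by linarith
  have pos: "0 < (eps d)\<^sup>2 + sig_s_min d * dt d"
    using assms by (simp add: add_pos_pos)
  show "0 < gam d i j"
    unfolding gam_def Gam_def using le pos assms(2) by (intro divide_pos_pos) auto
  show "gam d i j \<le> gam_max d"
    unfolding gam_def Gam_def gam_max_def using le pos by (intro divide_left_mono) auto
qed

lemma gamh_bounds:
  assumes "\<And>i j. 0 < gam d i j" "\<And>i j. gam d i j \<le> M"
  shows "0 \<le> gamh d p q" "gamh d p q \<le> M"
proof -
  have M: "0 < M"
    using assms(1)[of 0 0] assms(2)[of 0 0] by linarith
  have inv: "inverse M \<le> inverse (gam d i j)" for i j
    using assms by (intro le_imp_inverse_le)
  have pos: "0 < inverse (gam d i j)" for i j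
    using assms(1) by simp
  \<comment> \<open>Here \<open>c\<close> is the number of averaged mesh values, 2 or 4, and
    \<open>s\<close> the sum of their inverses, each at least \<open>inverse M\<close>.\<close>
  have le: "c / s \<le> M" if "c * inverse M \<le> s" "c > 0" for c s
  proof -
    have "0 < c * inverse M"
      using that M by simp
    then have "c / s \<le> c / (c * inverse M)"
      using that by (intro divide_left_mono) auto
    then show ?thesis
      using that(2) M by (simp add: field_simps)
  qed
  show "gamh d p q \<le> M"
    using inv[of "p div 2" "q div 2"] inv[of "p div 2 + 1" "q div 2"]
      inv[of "p div 2" "q div 2 + 1"] inv[of "p div 2 + 1" "q div 2 + 1"]
    by (auto simp: gamh_def Let_def assms(2) intro!: le)
  show "0 \<le> gamh d p q"
    using less_imp_le[OF pos] less_imp_le[OF assms(1)] by (auto simp: gamh_def Let_def)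
qed

section \<open>Positivity of the macro scheme\<close>

theorem theorem4p1:
  fixes d :: scheme_data
    and u :: "nat \<Rightarrow> int \<Rightarrow> int \<Rightarrow> real"
    and v :: "nat \<Rightarrow> int \<Rightarrow> int \<Rightarrow> hvec"
    and U :: "int \<Rightarrow> int \<Rightarrow> hvec"
    and n :: nat
  assumes "max_deg d \<ge> 1"
    and "eps d > 0"
    and "sig_s_min d > 0"
    and "\<forall>p. sig_s d p \<ge> sig_s_min d"
    and "\<forall>p. sig_a d p \<ge> 0"
    and "sig_F d > 0"
    and "\<forall>r\<ge>0. 0 \<le> filt d r \<and> filt d r \<le> 1"
    and "filt d 0 = 1"
    and "\<forall>l\<in>{1..max_deg d}. filt d (real l / (real (max_deg d) + 1)) \<noteq> 0"
    and "dx d > 0" and "dy d > 0" and "dt d > 0"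
    and "\<forall>i. mesh_x d (i + 1) = mesh_x d i + dx d"
    and "\<forall>j. mesh_y d (j + 1) = mesh_y d j + dy d"
    and "1 < theta d" and "theta d < 2"
    and scheme: "macro_step d (u n) (v n) (u (Suc n))"
    and u_nonneg: "\<forall>i j. u n i j \<ge> 0"
    and U_eq: "\<forall>i j. U i j = augment (u n i j) (\<lambda>p. eps d * v n i j p)"
    and C1: "\<forall>i j. \<forall>s\<in>{1, -1}. u n i j + s * eps d * dot_micro (max_deg d) a_x (v n i j) \<ge> 0"
    and C2: "\<forall>i j. \<forall>s\<in>{1, -1}. u n i j + s * eps d * dot_micro (max_deg d) a_y (v n i j) \<ge> 0"
    and C3: "\<forall>i j. u n i j \<ge> dot_full (max_deg d) ahat_xx (U i j)
                 \<and> dot_full (max_deg d) ahat_xx (U i j) \<ge> 0"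
    and C4: "\<forall>i j. u n i j \<ge> dot_full (max_deg d) ahat_yy (U i j)
                 \<and> dot_full (max_deg d) ahat_yy (U i j) \<ge> 0"
    and C5: "\<forall>i j. \<forall>s\<in>{1, -1}. u n i j + s * 2 * dot_full (max_deg d) ahat_xy (U i j) \<ge> 0"
    and C6: "\<forall>i j. \<forall>s\<in>{1, -1}.
               dot_full (max_deg d)
                 (\<lambda>p. ahat_xx p / (dx d)\<^sup>2 + s * 2 * (ahat_xy p / (dx d * dy d))
                      + ahat_yy p / (dy d)\<^sup>2) (U i j) \<ge> 0"
    and C7: "1 - gam_max d *
               (2 * Theta d * dt d / (eps d * dx d) + 2 * Theta d * dt d / (eps d * dy d)
                + 2 * (dt d)\<^sup>2 / ((eps d)\<^sup>2 * (dx d)\<^sup>2)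
                + (dt d)\<^sup>2 / (2 * (eps d)\<^sup>2 * dx d * dy d)
                + 2 * (dt d)\<^sup>2 / ((eps d)\<^sup>2 * (dy d)\<^sup>2)) \<ge> 0"
  shows "\<forall>i j. u (Suc n) i j \<ge> 0"
proof (intro allI)
  fix i j :: int
  let ?N = "max_deg d" and ?M = "gam_max d"
  note gam = gam_bounds[OF assms(1-7,9,12)]
  note gamh = gamh_bounds[OF gam]
  define A where "A i j = u n i j / 3 + eps d * dot_micro ?N a_xx (v n i j)" for i j
  define B where "B i j = u n i j / 3 + eps d * dot_micro ?N a_yy (v n i j)" for i j
  define C where "C i j = eps d * dot_micro ?N a_xy (v n i j)" for i j
  have dots: "dot_full ?N ahat_xx (U i j) = A i j" "dot_full ?N ahat_yy (U i j) = B i j"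
      "dot_full ?N ahat_xy (U i j) = C i j" for i j
    using U_eq by (simp_all add: dot_full_augment ahat_xx_def ahat_yy_def ahat_xy_def
        dot_micro_augment dot_micro_scale A_def B_def C_def) (simp_all add: augment_def)
  \<comment> \<open>(C6) pairs U with one combined vector; linearity splits it into the second
    moments.\<close>
  have comb: "dot_full ?N (\<lambda>p. ahat_xx p / (dx d)\<^sup>2 + s * 2 * (ahat_xy p / (dx d * dy d))
      + ahat_yy p / (dy d)\<^sup>2) (U i j)
      = A i j / (dx d)\<^sup>2 + s * 2 * (C i j / (dx d * dy d)) + B i j / (dy d)\<^sup>2" for s i j
    unfolding dots[symmetric] dot_full_def
    by (simp add: sum.distrib sum_distrib_left sum_divide_distrib ring_distribs mult_ac)
  have CP: "0 \<le> A i j / (dx d)\<^sup>2 + 2 * C i j / (dx d * dy d) + B i j / (dy d)\<^sup>2"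
    and CN: "0 \<le> A i j / (dx d)\<^sup>2 - 2 * C i j / (dx d * dy d) + B i j / (dy d)\<^sup>2" for i j
    using C6[unfolded comb] by auto
  have "0 \<le> u n i j + 2 * C i j" "0 \<le> u n i j - 2 * C i j"
    using C5[unfolded dots] by auto
  then have C: "2 * \<bar>C i j\<bar> \<le> u n i j"
    by auto
  have A: "0 \<le> A i j" "A i j \<le> u n i j" and B: "0 \<le> B i j" "B i j \<le> u n i j" for i j
    using C3[unfolded dots] C4[unfolded dots] by auto
  have diffusion: "(dt d)\<^sup>2 / eps d * D_micro d (v n) i j + (dt d)\<^sup>2 / (eps d)\<^sup>2 * D_macro d (u n) i j
      \<ge> (dt d)\<^sup>2 / (eps d)\<^sup>2
        * - (?M * u n i j * (2 / (dx d)\<^sup>2 + 1 / (2 * dx d * dy d) + 2 / (dy d)\<^sup>2))"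
    unfolding diffusion_eq[OF less_imp_neq[OF assms(2), symmetric]]
      A_def[symmetric] B_def[symmetric] C_def[symmetric]
    by (intro mult_left_mono diffusion_ge gamh A B C CP CN assms(10,11)) simp_all
  have ax: "eps d * \<bar>dot_micro ?N a_x (v n i j)\<bar> \<le> u n i j"
    and ay: "eps d * \<bar>dot_micro ?N a_y (v n i j)\<bar> \<le> u n i j" for i j
    using C1[rule_format, of 1 i j] C1[rule_format, of "-1" i j]
      C2[rule_format, of 1 i j] C2[rule_format, of "-1" i j] by (auto simp: abs_if)
  have th: "0 \<le> theta d" "theta d < 2"
    using assms by auto
  note advection_x = advection_dissip_ge[OF assms(10,2) th, of "\<lambda>i. u n i j" "\<lambda>i. gam d i j" ?M
      "\<lambda>i. dot_micro ?N a_x (v n i j)" i, OF u_nonneg[rule_format] less_imp_le[OF gam(1)] gam(2) ax]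
  note advection_y = advection_dissip_ge[OF assms(11,2) th, of "\<lambda>j. u n i j" "\<lambda>j. gam d i j" ?M
      "\<lambda>j. dot_micro ?N a_y (v n i j)" j, OF u_nonneg[rule_format] less_imp_le[OF gam(1)] gam(2) ay]
  have "- (dt d * (2 * Theta d * ?M * u n i j / (eps d * dx d) + 2 * Theta d * ?M * u n i j / (eps d * dy d)))
      \<le> - dt d * (advection d (v n) i j
          - Theta d * (?M / eps d)
            * (dx d ^ 3 * dissip (theta d) (dx d) (\<lambda>i'. u n i' j) i
               + dy d ^ 3 * dissip (theta d) (dy d) (\<lambda>j'. u n i j') j))"
    using mult_left_mono[OF add_mono[OF advection_x advection_y], of "dt d"] assms(12)
    by (simp add: advection_eq Theta_def[symmetric] algebra_simps)
  \<comment> \<open>Multiplied by the central value, (C7) says that this value outweighs the losses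
    in the advection and diffusion bounds.\<close>
  moreover have "0 \<le> u n i j * (1 - gam_max d *
               (2 * Theta d * dt d / (eps d * dx d) + 2 * Theta d * dt d / (eps d * dy d)
                + 2 * (dt d)\<^sup>2 / ((eps d)\<^sup>2 * (dx d)\<^sup>2)
                + (dt d)\<^sup>2 / (2 * (eps d)\<^sup>2 * dx d * dy d)
                + 2 * (dt d)\<^sup>2 / ((eps d)\<^sup>2 * (dy d)\<^sup>2)))"
    using C7 u_nonneg by simp
  moreover have "\<dots> = u n i j
      - dt d * (2 * Theta d * ?M * u n i j / (eps d * dx d) + 2 * Theta d * ?M * u n i j / (eps d * dy d))
      + (dt d)\<^sup>2 / (eps d)\<^sup>2
        * - (?M * u n i j * (2 / (dx d)\<^sup>2 + 1 / (2 * dx d * dy d) + 2 / (dy d)\<^sup>2))"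
    by (simp add: algebra_simps add_divide_distrib)
  ultimately have "0 \<le> u n i j
        + (dt d)\<^sup>2 / eps d * D_micro d (v n) i j
        + (dt d)\<^sup>2 / (eps d)\<^sup>2 * D_macro d (u n) i j
        - dt d * (advection d (v n) i j
                  - Theta d * (gam_max d / eps d)
                    * (dx d ^ 3 * dissip (theta d) (dx d) (\<lambda>i'. u n i' j) i
                       + dy d ^ 3 * dissip (theta d) (dy d) (\<lambda>j'. u n i j') j))"
    using diffusion by linarith
  then have "0 \<le> (1 + sa_mesh d i j * dt d) * u (Suc n) i j"
    using scheme by (simp add: macro_step_def)
  moreover have "0 < 1 + sa_mesh d i j * dt d"
    using assms(5,12) by (simp add: sa_mesh_def add_pos_nonneg)
  ultimately show "0 \<le> u (Suc n) i j"
    by (simp add: zero_le_mult_iff)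
qed

end
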